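(* Let $X_n$, $n\geq 1$, be a sequence of real random variables that is centered, L-weakly dependent, strictly stationary and square integrable. Let $S_n=X_1+\cdots+X_n$ and assume that $\frac1n\mathbb{E}S_n^2\to\sigma^2$ as $n\to\infty$ for some $\sigma^2\in(0,\infty)$. Then $\frac{1}{\sqrt n}S_n$ converges in distribution to a centered normal random variable with variance $\sigma^2$.
   Context: L-weak dependence: real random variables $X_n$, $n\ge1$, are L-weakly dependent with nonnegative coefficients $\gamma_k$, $k\ge1$, if $\sum_{k\ge1}\gamma_k<\infty$ and for all disjoint finite subsets $I,J\subset\{1,2,\ldots\}$ and all real valued Lipschitz functions $f:\mathbb{R}^I\to\mathbb{R}$, $g:\mathbb{R}^J\to\mathbb{R}$, the covariance below is well defined and $$|\mathrm{Cov}(f(X_i,i\in I),g(X_j,j\in J))|\le \|f\|_L\|g\|_L\sum_{i\in I}\sum_{j\in J}\gamma_{|j-i|},$$ where $\|f\|_L=\sup_{x\neq y}\frac{|f(x)-f(y)|}{|x-y|}$ and $|x-y|=\sum_i|x_i-y_i|$ is the $\ell^1$ distance. *)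

theory Defs
  imports "HOL-Probability.Probability"
begin

text \<open>
  For finite \<open>I\<close>, the space \<open>\<real>\<^sup>I\<close> is represented by the functions in
  \<open>I \<rightarrow>\<^sub>E UNIV\<close>, which take the value \<open>undefined\<close> outside \<open>I\<close>; this is also the
  carrier of the product space \<open>Pi\<^sub>M I (\<lambda>_. borel)\<close>. Values of a function on
  \<open>\<real>\<^sup>I\<close> outside this set are never used.
\<close>

definition l1_dist :: "nat set \<Rightarrow> (nat \<Rightarrow> real) \<Rightarrow> (nat \<Rightarrow> real) \<Rightarrow> real" where
  "l1_dist I x y = (\<Sum>i\<in>I. \<bar>x i - y i\<bar>)"

definition Lipschitz_fun :: "nat set \<Rightarrow> ((nat \<Rightarrow> real) \<Rightarrow> real) \<Rightarrow> bool" where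
  "Lipschitz_fun I f \<longleftrightarrow>
     (\<exists>C. \<forall>x \<in> I \<rightarrow>\<^sub>E UNIV. \<forall>y \<in> I \<rightarrow>\<^sub>E UNIV. \<bar>f x - f y\<bar> \<le> C * l1_dist I x y)"

text \<open>
  The supremum is taken in \<open>[0, \<infinity>)\<close>: inserting \<open>0\<close> only matters for \<open>I = {}\<close>, where
  \<open>\<real>\<^sup>I\<close> is a single point and there are no difference quotients.
\<close>

definition Lipschitz_norm :: "nat set \<Rightarrow> ((nat \<Rightarrow> real) \<Rightarrow> real) \<Rightarrow> real" where
  "Lipschitz_norm I f =
     Sup (insert 0 {\<bar>f x - f y\<bar> / l1_dist I x y | x y.
                      x \<in> I \<rightarrow>\<^sub>E UNIV \<and> y \<in> I \<rightarrow>\<^sub>E UNIV \<and> x \<noteq> y})"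

definition covariance :: "'a measure \<Rightarrow> ('a \<Rightarrow> real) \<Rightarrow> ('a \<Rightarrow> real) \<Rightarrow> real" where
  "covariance M U V =
     (\<integral>\<omega>. (U \<omega> - (\<integral>\<omega>'. U \<omega>' \<partial>M)) * (V \<omega> - (\<integral>\<omega>'. V \<omega>' \<partial>M)) \<partial>M)"

text \<open>Needed because the Bochner integral of a non-integrable function is \<open>0\<close> by convention.\<close>

definition covariance_well_defined ::
    "'a measure \<Rightarrow> ('a \<Rightarrow> real) \<Rightarrow> ('a \<Rightarrow> real) \<Rightarrow> bool" where
  "covariance_well_defined M U V \<longleftrightarrow>
     integrable M U \<and> integrable M V \<and> integrable M (\<lambda>\<omega>. U \<omega> * V \<omega>)"

definition subvector :: "(nat \<Rightarrow> 'a \<Rightarrow> real) \<Rightarrow> nat set \<Rightarrow> 'a \<Rightarrow> nat \<Rightarrow> real" where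
  "subvector X I \<omega> = (\<lambda>i\<in>I. X i \<omega>)"

text \<open>
  Sequences are indexed by \<open>n \<ge> 1\<close>; the values \<open>X 0\<close> and \<open>\<gamma> 0\<close> play no role.
\<close>

definition L_weakly_dependent ::
    "'a measure \<Rightarrow> (nat \<Rightarrow> 'a \<Rightarrow> real) \<Rightarrow> (nat \<Rightarrow> real) \<Rightarrow> bool" where
  "L_weakly_dependent M X \<gamma> \<longleftrightarrow>
     (\<forall>k\<ge>1. 0 \<le> \<gamma> k) \<and> summable (\<lambda>k. \<gamma> (Suc k)) \<and>
     (\<forall>I J f g. finite I \<longrightarrow> finite J \<longrightarrow> I \<subseteq> {1..} \<longrightarrow> J \<subseteq> {1..} \<longrightarrow> I \<inter> J = {} \<longrightarrow>
        Lipschitz_fun I f \<longrightarrow> Lipschitz_fun J g \<longrightarrow>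
        covariance_well_defined M (\<lambda>\<omega>. f (subvector X I \<omega>)) (\<lambda>\<omega>. g (subvector X J \<omega>)) \<and>
        \<bar>covariance M (\<lambda>\<omega>. f (subvector X I \<omega>)) (\<lambda>\<omega>. g (subvector X J \<omega>))\<bar>
          \<le> Lipschitz_norm I f * Lipschitz_norm J g *
             (\<Sum>i\<in>I. \<Sum>j\<in>J. \<gamma> (nat \<bar>int j - int i\<bar>)))"

definition strictly_stationary :: "'a measure \<Rightarrow> (nat \<Rightarrow> 'a \<Rightarrow> real) \<Rightarrow> bool" where
  "strictly_stationary M X \<longleftrightarrow>
     (\<forall>I h. finite I \<longrightarrow> I \<subseteq> {1..} \<longrightarrow>
        distr M (Pi\<^sub>M I (\<lambda>_. borel)) (subvector (\<lambda>i. X (i + h)) I)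
          = distr M (Pi\<^sub>M I (\<lambda>_. borel)) (subvector X I))"

end

theory Submission
  imports Defs "HOL-Real_Asymp.Real_Asymp"
begin

text \<open>
  Cut \<open>S\<^sub>n\<close> into \<open>n div l\<close> adjacent blocks of fixed length \<open>l\<close> and a remainder of fewer than \<open>l\<close>
  terms, which is negligible after division by \<open>sqrt n\<close>. The functions \<open>cos\<close> and \<open>sin\<close> of a multiple
  \<open>s = t / sqrt n\<close> of a block sum have Lipschitz norm at most \<open>\<bar>s\<bar>\<close>, so splitting off one
  block from the characteristic function costs at most \<open>4 s\<^sup>2 (T\<^sub>0 + \<dots> + T\<^sub>l\<^sub>-\<^sub>1)\<close>, where \<open>T\<^sub>r\<close> is the tail
  of the series of the coefficients after its first \<open>r\<close> terms. The total cost is at most \<open>4 t\<^sup>2\<close> times the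
  mean of \<open>T\<^sub>0, \<dots>, T\<^sub>l\<^sub>-\<^sub>1\<close>, uniformly in \<open>n\<close>, and tends to \<open>0\<close> as \<open>l\<close> grows. By stationarity what is left is a
  power of the characteristic function of \<open>S\<^sub>l\<close>, for which the argument of the i.i.d. case gives the limit
  \<open>exp (- t\<^sup>2 E[S\<^sub>l\<^sup>2] / (2 l))\<close> as \<open>n\<close> grows. Now let \<open>l\<close> tend to infinity.
\<close>

section \<open>Elementary limits and the characteristic function of the normal law\<close>

lemma cesaro_mean_tendsto_0:
  fixes a :: "nat \<Rightarrow> real"
  assumes "a \<longlonglongrightarrow> 0"
  shows "(\<lambda>n. (\<Sum>i<n. a i) / real n) \<longlonglongrightarrow> 0"
proof (rule LIMSEQ_I)
  fix e :: real assume e: "0 < e"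
  obtain N where N: "\<And>n. n \<ge> N \<Longrightarrow> \<bar>a n\<bar> < e / 2"
    using LIMSEQ_D[OF assms, of "e / 2"] e by auto
  \<comment> \<open>\<open>K\<close> bounds the contribution of the first \<open>N\<close> terms
    whatever \<open>n\<close> is; divided by \<open>n\<close> it falls below \<open>e / 2\<close>
    once \<open>n > 2 * K / e\<close>. The later terms contribute at most \<open>e / 2\<close> to
    the mean.\<close>
  define K where "K = (\<Sum>i<N. \<bar>a i\<bar>)"
  obtain n0 where n0: "2 * K / e < real n0" using reals_Archimedean2 by blast
  show "\<exists>no. \<forall>n\<ge>no. norm ((\<Sum>i<n. a i) / real n - 0) < e"
  proof (intro exI[of _ "max (Suc n0) N"] allI impI)
    fix n assume n: "max (Suc n0) N \<le> n"
    have "real n0 < real n" using n by simp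
    with n0 have "2 * K / e < real n" by linarith
    hence K: "K < real n * (e / 2)" using e by (simp add: field_simps)
    have "\<bar>\<Sum>i<n. a i\<bar> \<le> (\<Sum>i<n. \<bar>a i\<bar>)" by (rule sum_abs)
    also have "(\<Sum>i<n. \<bar>a i\<bar>) = K + (\<Sum>i=N..<n. \<bar>a i\<bar>)"
      using n sum.atLeastLessThan_concat[of 0 N n "\<lambda>i. \<bar>a i\<bar>"] by (simp add: K_def lessThan_atLeast0)
    also have "(\<Sum>i=N..<n. \<bar>a i\<bar>) \<le> (\<Sum>i=N..<n. e / 2)"
      by (intro sum_mono) (use N in \<open>force\<close>)
    also have "\<dots> \<le> real n * (e / 2)" using e by (simp add: mult_right_mono)
    finally have "\<bar>\<Sum>i<n. a i\<bar> < real n * e" using K by simp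
    thus "norm ((\<Sum>i<n. a i) / real n - 0) < e" using n by (simp add: field_simps)
  qed
qed

lemma tendsto_divide_sqrt_0: "(\<lambda>n. t / sqrt (real n)) \<longlonglongrightarrow> 0"
  by (rule tendsto_divide_0[OF tendsto_const filterlim_at_top_imp_at_infinity
        [OF filterlim_compose[OF sqrt_at_top filterlim_real_sequentially]]])

text \<open>A centered normal variable with standard deviation \<sigma> is \<sigma> times a standard
  one, so its characteristic function is the standard one with argument
  \<open>\<sigma> * t\<close>.\<close>

lemma char_normal_density:
  assumes "\<sigma> > 0"
  shows "char (density lborel (normal_density 0 \<sigma>)) t = complex_of_real (exp (- (\<sigma> * t)\<^sup>2 / 2))"
proof -
  interpret N: prob_space std_normal_distribution
    by (rule prob_space_normal_density) simp
  have "distributed std_normal_distribution lborel (\<lambda>x. x) (normal_density 0 1)"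
    by (auto simp: distributed_def distr_id2)
  from N.normal_density_affine[OF this, of \<sigma> 0] assms
  have eq: "distr std_normal_distribution borel (\<lambda>x. \<sigma> * x) = density lborel (normal_density 0 \<sigma>)"
    by (simp add: distributed_def cong: distr_cong)
  have "char (density lborel (normal_density 0 \<sigma>)) t = char std_normal_distribution (\<sigma> * t)"
    unfolding eq[symmetric] char_def
    by (subst integral_distr) (auto simp: ac_simps)
  thus ?thesis by (simp add: char_std_normal_distribution)
qed

section \<open>Characteristic functions of random variables\<close>

context prob_space
begin

lemma char_distr:
  assumes [measurable]: "U \<in> borel_measurable M"
  shows "char (distr M borel U) s = (CLINT \<omega>|M. iexp (s * U \<omega>))"
  unfolding char_def by (subst integral_distr) auto

lemma norm_char_distr_le_1:
  assumes "U \<in> borel_measurable M"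
  shows "norm (char (distr M borel U) s) \<le> 1"
proof -
  interpret D: real_distribution "distr M borel U" using assms by (rule real_distribution_distr)
  show ?thesis by (rule D.cmod_char_le_1)
qed

lemma integrable_iexp_mult [simp]:
  assumes [measurable]: "U \<in> borel_measurable M"
  shows "integrable M (\<lambda>\<omega>. iexp (s * U \<omega>))"
  by (rule integrable_const_bound[of _ 1]) auto

text \<open>Factoring out \<open>iexp (s * v)\<close>, which has modulus 1, reduces the claim to
  \<open>norm (iexp z - 1) \<le> \<bar>z\<bar>\<close> for real \<open>z\<close>. This serves to
  discard the remainder after the last full block.\<close>

lemma norm_char_distr_diff_le:
  assumes [measurable]: "U \<in> borel_measurable M" "V \<in> borel_measurable M"
    and "integrable M (\<lambda>\<omega>. U \<omega> - V \<omega>)"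
  shows "norm (char (distr M borel U) s - char (distr M borel V) s)
           \<le> \<bar>s\<bar> * (\<integral>\<omega>. \<bar>U \<omega> - V \<omega>\<bar> \<partial>M)"
proof -
  have *: "norm (iexp (s * u) - iexp (s * v)) \<le> \<bar>s\<bar> * \<bar>u - v\<bar>" for u v
  proof -
    have "iexp (s * u) - iexp (s * v) = iexp (s * v) * (iexp (s * (u - v)) - 1)"
      by (simp add: algebra_simps flip: exp_add)
    hence "norm (iexp (s * u) - iexp (s * v)) = norm (iexp (s * (u - v)) - 1)"
      by (simp add: norm_mult)
    also have "\<dots> \<le> \<bar>s * (u - v)\<bar>" using iexp_approx1[of "s * (u - v)" 0] by simp
    finally show ?thesis by (simp add: abs_mult)
  qed
  have "norm (char (distr M borel U) s - char (distr M borel V) s)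
      = norm (CLINT \<omega>|M. iexp (s * U \<omega>) - iexp (s * V \<omega>))"
    by (simp add: char_distr Bochner_Integration.integral_diff[OF integrable_iexp_mult integrable_iexp_mult]
          del: of_real_mult)
  also have "\<dots> \<le> (\<integral>\<omega>. norm (iexp (s * U \<omega>) - iexp (s * V \<omega>)) \<partial>M)"
    by (rule integral_norm_bound)
  also have "\<dots> \<le> (\<integral>\<omega>. \<bar>s\<bar> * \<bar>U \<omega> - V \<omega>\<bar> \<partial>M)"
    using * assms(3)
    by (intro integral_mono integrable_norm Bochner_Integration.integrable_diff integrable_iexp_mult) auto
  finally show ?thesis by simp
qed

text \<open>Weak dependence concerns real functions, so the exponential is split into cosine and
  sine. By the addition formulas the difference is a combination of four covariances with
  coefficients of modulus 1, hence the factor 4.\<close>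

lemma norm_char_distr_add_diff_le:
  assumes [measurable]: "U \<in> borel_measurable M" "V \<in> borel_measurable M"
    and bound: "\<And>f g. f \<in> {cos, sin} \<Longrightarrow> g \<in> {cos, sin} \<Longrightarrow>
      \<bar>covariance M (\<lambda>\<omega>. f (s * U \<omega>)) (\<lambda>\<omega>. g (s * V \<omega>))\<bar> \<le> K"
  shows "norm (char (distr M borel (\<lambda>\<omega>. U \<omega> + V \<omega>)) s
            - char (distr M borel U) s * char (distr M borel V) s) \<le> 4 * K"
proof -
  define C where "C f g = covariance M (\<lambda>\<omega>. f (s * U \<omega>)) (\<lambda>\<omega>. g (s * V \<omega>))"
    for f g :: "real \<Rightarrow> real"
  have meas: "f \<in> borel_measurable borel" if "f \<in> {cos, sin}" for f :: "real \<Rightarrow> real"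
    using that by (auto intro!: borel_measurable_continuous_onI continuous_intros)
  have le1: "\<bar>f x\<bar> \<le> 1" if "f \<in> {cos, sin}" for f :: "real \<Rightarrow> real" and x using that by auto
  have int1: "integrable M (\<lambda>\<omega>. f (s * W \<omega>))" if "f \<in> {cos, sin}" "W \<in> borel_measurable M"
    for f :: "real \<Rightarrow> real" and W
    using le1[OF that(1)] meas[OF that(1)] that(2)
    by (intro integrable_const_bound[of _ 1]) auto
  have int2: "integrable M (\<lambda>\<omega>. f (s * U \<omega>) * g (s * V \<omega>))"
    if "f \<in> {cos, sin}" "g \<in> {cos, sin}" for f g :: "real \<Rightarrow> real"
    using le1[OF that(1)] le1[OF that(2)] meas[OF that(1)] meas[OF that(2)]
    by (intro integrable_const_bound[of _ 1]) (auto simp: abs_mult intro!: mult_le_one)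
  have C_eq: "C f g = (\<integral>\<omega>. f (s * U \<omega>) * g (s * V \<omega>) \<partial>M)
      - (\<integral>\<omega>. f (s * U \<omega>) \<partial>M) * (\<integral>\<omega>. g (s * V \<omega>) \<partial>M)"
    if fg: "f \<in> {cos, sin}" "g \<in> {cos, sin}" for f g
  proof -
    have [simp]: "integrable M (\<lambda>\<omega>. f (s * U \<omega>))" "integrable M (\<lambda>\<omega>. g (s * V \<omega>))"
      "integrable M (\<lambda>\<omega>. f (s * U \<omega>) * g (s * V \<omega>))"
      using int1 int2 fg by auto
    show ?thesis unfolding C_def covariance_def
      by (simp add: algebra_simps prob_space)
  qed
  define cu su cv sv where
    "cu = (\<integral>\<omega>. cos (s * U \<omega>) \<partial>M)" and "su = (\<integral>\<omega>. sin (s * U \<omega>) \<partial>M)" and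
    "cv = (\<integral>\<omega>. cos (s * V \<omega>) \<partial>M)" and "sv = (\<integral>\<omega>. sin (s * V \<omega>) \<partial>M)"
  have char_eq: "char (distr M borel W) s
      = Complex (\<integral>\<omega>. cos (s * W \<omega>) \<partial>M) (\<integral>\<omega>. sin (s * W \<omega>) \<partial>M)"
    if [measurable]: "W \<in> borel_measurable M" for W
  proof -
    have "Re (CLINT \<omega>|M. iexp (s * W \<omega>)) = (\<integral>\<omega>. cos (s * W \<omega>) \<partial>M)"
         "Im (CLINT \<omega>|M. iexp (s * W \<omega>)) = (\<integral>\<omega>. sin (s * W \<omega>) \<partial>M)"
      using integral_Re[OF integrable_iexp_mult[OF that, of s]]
            integral_Im[OF integrable_iexp_mult[OF that, of s]]
      by (simp_all add: Re_exp Im_exp)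
    thus ?thesis by (simp add: char_distr complex_eq_iff)
  qed
  have "(\<integral>\<omega>. cos (s * (U \<omega> + V \<omega>)) \<partial>M) = C cos cos + cu * cv - (C sin sin + su * sv)"
    unfolding cu_def cv_def su_def sv_def
    by (simp add: C_eq distrib_left cos_add int2)
  moreover have "(\<integral>\<omega>. sin (s * (U \<omega> + V \<omega>)) \<partial>M) = C sin cos + su * cv + (C cos sin + cu * sv)"
    unfolding cu_def cv_def su_def sv_def
    by (simp add: C_eq distrib_left sin_add int2)
  \<comment> \<open>The products of expectations recombine to the product of the two characteristic
    functions; only covariances survive.\<close>
  ultimately have eq: "char (distr M borel (\<lambda>\<omega>. U \<omega> + V \<omega>)) s
            - char (distr M borel U) s * char (distr M borel V) s
      = Complex (C cos cos - C sin sin) (C sin cos + C cos sin)"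
    by (simp add: char_eq complex_eq_iff flip: cu_def cv_def su_def sv_def)
  have "norm (Complex (C cos cos - C sin sin) (C sin cos + C cos sin))
      \<le> \<bar>C cos cos - C sin sin\<bar> + \<bar>C sin cos + C cos sin\<bar>"
    using cmod_le[of "Complex (C cos cos - C sin sin) (C sin cos + C cos sin)"] by simp
  also have "\<dots> \<le> 4 * K"
  proof -
    have "\<bar>C f g\<bar> \<le> K" if "f \<in> {cos, sin}" "g \<in> {cos, sin}" for f g
      unfolding C_def by (rule bound[OF that])
    from this[OF insertI1 insertI1] this[OF insertI2[OF singletonI] insertI2[OF singletonI]]
      this[OF insertI2[OF singletonI] insertI1] this[OF insertI1 insertI2[OF singletonI]]
    show ?thesis by linarith
  qed
  finally show ?thesis unfolding eq .
qed

text \<open>This is the i.i.d. argument: at \<open>t / sqrt (real n)\<close> the characteristic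
  function is \<open>1 - a / n\<close> up to an error of smaller order than \<open>1 / n\<close>,
  and about \<open>c * n\<close> such factors are multiplied.\<close>

lemma char_power_tendsto:
  assumes [measurable]: "U \<in> borel_measurable M"
    and int: "integrable M U" and int2: "integrable M (\<lambda>\<omega>. (U \<omega>)\<^sup>2)" and mean: "expectation U = 0"
    and m: "(\<lambda>n. real (m n) / real n) \<longlonglongrightarrow> c"
  shows "(\<lambda>n. char (distr M borel U) (t / sqrt (real n)) ^ m n)
           \<longlonglongrightarrow> complex_of_real (exp (- (c * expectation (\<lambda>\<omega>. (U \<omega>)\<^sup>2) * t\<^sup>2 / 2)))"
proof -
  define v where "v = expectation (\<lambda>\<omega>. (U \<omega>)\<^sup>2)"
  define a where "a = t\<^sup>2 * v / 2"
  have v0: "v \<ge> 0" unfolding v_def by simp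
  hence a0: "a \<ge> 0" unfolding a_def by simp
  let ?\<phi> = "\<lambda>n. char (distr M borel U) (t / sqrt (real n))"
  \<comment> \<open>\<open>R n / n\<close> is the error of the second-order Taylor expansion given
    by \<open>char_approx3'\<close>. The minimum is dominated by
    \<open>6 * (U \<omega>)\<^sup>2\<close>, so finite second moments suffice for \<open>R\<close>
    to vanish.\<close>
  define R where "R n = t\<^sup>2 / 6 * expectation (\<lambda>\<omega>. min (6 * (U \<omega>)\<^sup>2) (\<bar>t / sqrt (real n)\<bar> * \<bar>U \<omega>\<bar> ^ 3))" for n
  \<comment> \<open>\<open>Q n / n\<close> is the error of replacing \<open>1 - a / n\<close> by
    \<open>exp (- (a / n))\<close>. The exponential never exceeds 1 since \<open>a \<ge> 0\<close>,
    as \<open>norm_power_diff\<close> requires, and its powers are explicit.\<close>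
  define Q where "Q n = real n * (exp (- (a / real n)) - (1 - a / real n))" for n
  have R: "R \<longlonglongrightarrow> 0"
  proof -
    have "(\<lambda>n. min (6 * x\<^sup>2) (\<bar>t / sqrt (real n)\<bar> * \<bar>x\<bar> ^ 3)) \<longlonglongrightarrow> 0" for x :: real
    proof -
      have "(\<lambda>n. \<bar>t / sqrt (real n)\<bar> * \<bar>x\<bar> ^ 3) \<longlonglongrightarrow> \<bar>0\<bar> * \<bar>x\<bar> ^ 3"
        by (intro tendsto_intros tendsto_divide_sqrt_0)
      hence "(\<lambda>n. min (6 * x\<^sup>2) (\<bar>t / sqrt (real n)\<bar> * \<bar>x\<bar> ^ 3)) \<longlonglongrightarrow> min (6 * x\<^sup>2) (\<bar>0\<bar> * \<bar>x\<bar> ^ 3)"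
        by (intro tendsto_min tendsto_const)
      thus ?thesis by simp
    qed
    hence "(\<lambda>n. expectation (\<lambda>\<omega>. min (6 * (U \<omega>)\<^sup>2) (\<bar>t / sqrt (real n)\<bar> * \<bar>U \<omega>\<bar> ^ 3)))
        \<longlonglongrightarrow> expectation (\<lambda>\<omega>. 0)"
      by (intro integral_dominated_convergence[where w = "\<lambda>\<omega>. 6 * (U \<omega>)\<^sup>2"])
        (use int2 in auto)
    from tendsto_mult[OF tendsto_const[of "t\<^sup>2 / 6"] this] show ?thesis by (simp add: R_def[abs_def])
  qed
  have Q: "Q \<longlonglongrightarrow> 0"
    unfolding Q_def by real_asymp
  have bound: "norm (?\<phi> n ^ m n - complex_of_real (exp (- (a / real n))) ^ m n)
        \<le> real (m n) / real n * (R n + \<bar>Q n\<bar>)" if n: "n > 0" for n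
  proof -
    let ?s = "t / sqrt (real n)"
    have s2: "?s\<^sup>2 = t\<^sup>2 / real n" by (simp add: power_divide)
    have "norm (?\<phi> n - (1 - ?s\<^sup>2 * v / 2))
       \<le> (?s\<^sup>2 / 6) * expectation (\<lambda>\<omega>. min (6 * (U \<omega>)\<^sup>2) (\<bar>?s\<bar> * \<bar>U \<omega>\<bar> ^ 3))"
      using char_approx3'[of U v "distr M borel U" ?s] int int2 mean by (simp add: v_def)
    also have "\<dots> = R n / real n" by (simp add: s2 R_def)
    finally have 1: "norm (?\<phi> n - complex_of_real (1 - a / real n)) \<le> R n / real n"
      by (simp add: a_def power_divide mult.commute flip: of_real_power)
    have "norm (complex_of_real (1 - a / real n) - complex_of_real (exp (- (a / real n))))
        = \<bar>1 - a / real n - exp (- (a / real n))\<bar>"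
      by (metis norm_of_real of_real_diff real_norm_def)
    also have "\<dots> = \<bar>Q n\<bar> / real n" using n by (simp add: Q_def abs_mult abs_minus_commute)
    finally have 2: "norm (complex_of_real (1 - a / real n) - complex_of_real (exp (- (a / real n))))
        \<le> \<bar>Q n\<bar> / real n" by simp
    have 3: "norm (?\<phi> n - complex_of_real (exp (- (a / real n)))) \<le> R n / real n + \<bar>Q n\<bar> / real n"
      using norm_triangle_mono[OF 1 2] by simp
    have "norm (?\<phi> n ^ m n - complex_of_real (exp (- (a / real n))) ^ m n)
       \<le> real (m n) * norm (?\<phi> n - complex_of_real (exp (- (a / real n))))"
      by (rule norm_power_diff) (use a0 in \<open>auto intro: norm_char_distr_le_1\<close>)
    also have "\<dots> \<le> real (m n) * (R n / real n + \<bar>Q n\<bar> / real n)"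
      by (rule mult_left_mono[OF 3]) simp
    finally show ?thesis by (simp add: distrib_left add_divide_distrib mult.commute)
  qed
  have "(\<lambda>n. real (m n) / real n * (R n + \<bar>Q n\<bar>)) \<longlonglongrightarrow> c * (0 + \<bar>0\<bar>)"
    by (intro tendsto_intros m R Q)
  hence diff: "(\<lambda>n. ?\<phi> n ^ m n - complex_of_real (exp (- (a / real n))) ^ m n) \<longlonglongrightarrow> 0"
    by (intro Lim_null_comparison[OF eventually_mono[OF eventually_gt_at_top[of 0] bound]]) simp_all
  have "(\<lambda>n. complex_of_real (exp (- (a * (real (m n) / real n))))) \<longlonglongrightarrow> complex_of_real (exp (- (a * c)))"
    by (intro tendsto_intros m)
  also have "(\<lambda>n. complex_of_real (exp (- (a * (real (m n) / real n)))))
      = (\<lambda>n. complex_of_real (exp (- (a / real n))) ^ m n)"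
    by (simp add: fun_eq_iff exp_of_nat_mult[symmetric] flip: of_real_power)
  finally have "(\<lambda>n. ?\<phi> n ^ m n) \<longlonglongrightarrow> complex_of_real (exp (- (a * c)))"
    by (rule Lim_transform[OF _ diff])
  thus ?thesis by (simp add: a_def v_def mult_ac)
qed

end

section \<open>Lipschitz functions of a sum\<close>

text \<open>By the triangle inequality summation has Lipschitz constant at most 1 for the l1
  distance. The third claim allows bounds on two Lipschitz norms to be multiplied.\<close>

lemma Lipschitz_sum_comp:
  fixes f :: "real \<Rightarrow> real"
  assumes f: "\<And>x y. \<bar>f x - f y\<bar> \<le> \<bar>x - y\<bar>" and fin: "finite I"
  shows "Lipschitz_fun I (\<lambda>x. f (s * (\<Sum>i\<in>I. x i)))"
    and "Lipschitz_norm I (\<lambda>x. f (s * (\<Sum>i\<in>I. x i))) \<le> \<bar>s\<bar>"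
    and "0 \<le> Lipschitz_norm I (\<lambda>x. f (s * (\<Sum>i\<in>I. x i)))"
proof -
  let ?F = "\<lambda>x. f (s * (\<Sum>i\<in>I. x i))"
  let ?A = "{\<bar>?F x - ?F y\<bar> / l1_dist I x y | x y.
                      x \<in> I \<rightarrow>\<^sub>E UNIV \<and> y \<in> I \<rightarrow>\<^sub>E UNIV \<and> x \<noteq> y}"
  have le: "\<bar>?F x - ?F y\<bar> \<le> \<bar>s\<bar> * l1_dist I x y" for x y
  proof -
    have "\<bar>?F x - ?F y\<bar> \<le> \<bar>s * (\<Sum>i\<in>I. x i) - s * (\<Sum>i\<in>I. y i)\<bar>" by (rule f)
    also have "\<dots> = \<bar>s\<bar> * \<bar>\<Sum>i\<in>I. x i - y i\<bar>"
      by (simp add: sum_subtractf abs_mult flip: right_diff_distrib)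
    also have "\<dots> \<le> \<bar>s\<bar> * l1_dist I x y"
      unfolding l1_dist_def by (intro mult_left_mono sum_abs) simp
    finally show ?thesis .
  qed
  show "Lipschitz_fun I ?F" unfolding Lipschitz_fun_def using le by blast
  have nn: "0 \<le> l1_dist I x y" for x y unfolding l1_dist_def by (simp add: sum_nonneg)
  have ub: "z \<le> \<bar>s\<bar>" if "z \<in> insert 0 ?A" for z
  proof -
    \<comment> \<open>Here \<open>x\<close> and \<open>y\<close> are arbitrary, so their distance
      may be 0; the quotient is then 0 by convention.\<close>
    have "\<bar>?F x - ?F y\<bar> / l1_dist I x y \<le> \<bar>s\<bar>" for x y
      using le[of x y] nn[of x y] by (cases "l1_dist I x y = 0") (auto simp: divide_le_eq)
    thus ?thesis using that by auto
  qed
  show "Lipschitz_norm I ?F \<le> \<bar>s\<bar>"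
    unfolding Lipschitz_norm_def by (rule cSup_least) (use ub in auto)
  show "0 \<le> Lipschitz_norm I ?F"
    unfolding Lipschitz_norm_def by (rule cSup_upper) (use ub in \<open>auto intro!: bdd_aboveI\<close>)
qed

section \<open>The sequence: moments and stationarity of its sums\<close>

locale L_weak_stationary_sequence = prob_space M for M :: "'a measure" +
  fixes X :: "nat \<Rightarrow> 'a \<Rightarrow> real" and \<gamma> :: "nat \<Rightarrow> real"
  assumes rv: "\<And>n. n \<ge> 1 \<Longrightarrow> X n \<in> borel_measurable M"
    and square_integrable: "\<And>n. n \<ge> 1 \<Longrightarrow> integrable M (\<lambda>\<omega>. (X n \<omega>)\<^sup>2)"
    and centered: "\<And>n. n \<ge> 1 \<Longrightarrow> expectation (X n) = 0"
    and dependent: "L_weakly_dependent M X \<gamma>"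
    and stationary: "strictly_stationary M X"
begin

declare One_nat_def [simp del] \<comment> \<open>so that \<open>auto\<close> leaves side conditions in the form \<open>n \<ge> 1\<close>\<close>

abbreviation S :: "nat set \<Rightarrow> 'a \<Rightarrow> real" where
  "S I \<equiv> \<lambda>\<omega>. \<Sum>i\<in>I. X i \<omega>"

abbreviation \<phi> :: "nat set \<Rightarrow> real \<Rightarrow> complex" where
  "\<phi> I \<equiv> char (distr M borel (S I))"

text \<open>The index at offset \<open>r\<close>, counted from 0, in a block has distances
  \<open>r + 1\<close>, \<open>r + 2\<close>, and so on to the indices before the block. Thus
  \<open>tail r\<close> bounds its total coefficient with the past, however long the past
  is.\<close>

definition tail :: "nat \<Rightarrow> real" where
  "tail r = (\<Sum>k. \<gamma> (Suc (k + r)))"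

lemma \<gamma>_nonneg: "k \<ge> 1 \<Longrightarrow> 0 \<le> \<gamma> k"
  using dependent unfolding L_weakly_dependent_def by auto

lemma summable_\<gamma>: "summable (\<lambda>k. \<gamma> (Suc k))"
  using dependent unfolding L_weakly_dependent_def by auto

lemma S_measurable: "I \<subseteq> {1..} \<Longrightarrow> S I \<in> borel_measurable M"
  by (intro borel_measurable_sum) (auto intro: rv)

lemma integrable_X: "n \<ge> 1 \<Longrightarrow> integrable M (X n)"
  by (rule square_integrable_imp_integrable[OF rv square_integrable])

lemma integrable_S: "I \<subseteq> {1..} \<Longrightarrow> integrable M (S I)"
  by (intro Bochner_Integration.integrable_sum) (auto intro: integrable_X)

lemma integrable_S_square:
  assumes "finite I" "I \<subseteq> {1..}" shows "integrable M (\<lambda>\<omega>. (S I \<omega>)\<^sup>2)"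
  using assms
proof (induction rule: finite_induct)
  case (insert i I)
  have m: "S I \<in> borel_measurable M" "X i \<in> borel_measurable M"
    using insert by (auto intro: S_measurable rv)
  have "integrable M (\<lambda>\<omega>. 2 * (X i \<omega>)\<^sup>2 + 2 * (S I \<omega>)\<^sup>2)"
    using insert by (auto intro!: square_integrable)
  thus ?case
  proof (rule Bochner_Integration.integrable_bound)
    show "(\<lambda>\<omega>. (S (insert i I) \<omega>)\<^sup>2) \<in> borel_measurable M" using insert m by simp
    have "(x + y)\<^sup>2 \<le> 2 * x\<^sup>2 + 2 * y\<^sup>2" for x y :: real
      using zero_le_power2[of "x - y"] by (simp add: power2_eq_square algebra_simps)
    thus "AE \<omega> in M. norm ((S (insert i I) \<omega>)\<^sup>2) \<le> norm (2 * (X i \<omega>)\<^sup>2 + 2 * (S I \<omega>)\<^sup>2)"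
      using insert by (intro AE_I2) simp
  qed
qed simp

lemma expectation_S:
  assumes "I \<subseteq> {1..}" shows "expectation (S I) = 0"
proof -
  have "expectation (S I) = (\<Sum>i\<in>I. expectation (X i))"
    by (rule Bochner_Integration.integral_sum) (use assms in \<open>auto intro: integrable_X\<close>)
  also have "\<dots> = 0" by (rule sum.neutral) (use assms in \<open>auto intro: centered\<close>)
  finally show ?thesis .
qed

text \<open>Stationarity equates the joint laws of the shifted and the original vector; their images
  under summation are the laws of the two block sums.\<close>

lemma distr_S_shift:
  "distr M borel (S {h + 1..h + l}) = distr M borel (S {1..l})"
proof -
  let ?P = "Pi\<^sub>M {1..l} (\<lambda>_. borel :: real measure)"
  have m: "subvector (\<lambda>i. X (i + k)) {1..l} \<in> measurable M ?P" for k
    unfolding subvector_def[abs_def] by (intro measurable_restrict) (auto intro: rv)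
  have m0: "subvector X {1..l} \<in> measurable M ?P" using m[of 0] by simp
  have f: "(\<lambda>x. \<Sum>i\<in>{1..l}. x i) \<in> borel_measurable ?P"
    by (intro borel_measurable_sum) simp
  have "S {h + 1..h + l} = (\<lambda>\<omega>. \<Sum>i\<in>{1..l}. subvector (\<lambda>i. X (i + h)) {1..l} \<omega> i)"
    using sum.shift_bounds_cl_nat_ivl[of "\<lambda>i. X i \<omega>" 1 h l for \<omega>]
    by (intro ext) (simp add: subvector_def add.commute)
  hence "distr M borel (S {h + 1..h + l})
      = distr (distr M ?P (subvector (\<lambda>i. X (i + h)) {1..l})) borel (\<lambda>x. \<Sum>i\<in>{1..l}. x i)"
    by (simp add: distr_distr[OF f m] comp_def)
  also have "distr M ?P (subvector (\<lambda>i. X (i + h)) {1..l}) = distr M ?P (subvector X {1..l})"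
    using stationary unfolding strictly_stationary_def by auto
  also have "distr \<dots> borel (\<lambda>x. \<Sum>i\<in>{1..l}. x i) = distr M borel (S {1..l})"
    by (simp add: distr_distr[OF f m0] comp_def subvector_def)
  finally show ?thesis .
qed

lemma expectation_abs_X:
  assumes "n \<ge> 1" shows "expectation (\<lambda>\<omega>. \<bar>X n \<omega>\<bar>) = expectation (\<lambda>\<omega>. \<bar>X 1 \<omega>\<bar>)"
proof -
  \<comment> \<open>A single term is a block of length 1.\<close>
  have d: "distr M borel (X n) = distr M borel (X 1)"
    using distr_S_shift[of "n - 1" 1] assms by simp
  have "expectation (\<lambda>\<omega>. \<bar>X n \<omega>\<bar>) = (\<integral>x. \<bar>x\<bar> \<partial>distr M borel (X n))"
    using rv[OF assms] by (subst integral_distr) auto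
  also have "\<dots> = expectation (\<lambda>\<omega>. \<bar>X 1 \<omega>\<bar>)"
    unfolding d using rv[of 1] by (subst integral_distr) auto
  finally show ?thesis .
qed

section \<open>Decoupling of blocks\<close>

text \<open>Cosine and sine of \<open>s\<close> times a sum have Lipschitz norm at most
  \<open>\<bar>s\<bar>\<close>, so each covariance carries a factor \<open>s\<^sup>2\<close>. For
  \<open>s = t / sqrt (real n)\<close> this is of order \<open>1 / n\<close>, which balances a
  number of blocks proportional to \<open>n\<close>.\<close>

lemma norm_\<phi>_union_diff_le:
  assumes I: "finite I" "I \<subseteq> {1..}" and J: "finite J" "J \<subseteq> {1..}" and disj: "I \<inter> J = {}"
  shows "norm (\<phi> (I \<union> J) s - \<phi> I s * \<phi> J s)
     \<le> 4 * (s\<^sup>2 * (\<Sum>i\<in>I. \<Sum>j\<in>J. \<gamma> (nat \<bar>int j - int i\<bar>)))"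
proof -
  have lip: "\<bar>f x - f y\<bar> \<le> \<bar>x - y\<bar>" if f: "f \<in> {cos, sin}" for f and x y :: real
  proof -
    consider "f = cos" | "f = sin" using f by auto
    hence "norm (f y - f x) \<le> 1 * norm (y - x)"
    proof cases
      case 1
      show ?thesis unfolding 1
        by (rule field_differentiable_bound[of UNIV cos "\<lambda>x. - sin x"]) (auto intro!: derivative_eq_intros)
    next
      case 2
      show ?thesis unfolding 2
        by (rule field_differentiable_bound[of UNIV sin cos]) (auto intro!: derivative_eq_intros)
    qed
    thus ?thesis by (simp add: abs_minus_commute)
  qed
  let ?G = "\<Sum>i\<in>I. \<Sum>j\<in>J. \<gamma> (nat \<bar>int j - int i\<bar>)"
  have G: "0 \<le> ?G"
  proof (intro sum_nonneg \<gamma>_nonneg)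
    fix i j assume "i \<in> I" "j \<in> J"
    \<comment> \<open>Disjointness keeps all distances at least 1, where the coefficients are known
      to be nonnegative.\<close>
    hence "i \<noteq> j" using disj by auto
    thus "1 \<le> nat \<bar>int j - int i\<bar>" by linarith
  qed
  have "\<bar>covariance M (\<lambda>\<omega>. f (s * S I \<omega>)) (\<lambda>\<omega>. g (s * S J \<omega>))\<bar> \<le> s\<^sup>2 * ?G"
    if fg: "f \<in> {cos, sin}" "g \<in> {cos, sin}" for f g
  proof -
    let ?F = "\<lambda>x. f (s * (\<Sum>i\<in>I. x i))" and ?H = "\<lambda>x. g (s * (\<Sum>i\<in>J. x i))"
    note F = Lipschitz_sum_comp[OF lip[OF fg(1)] I(1), of s]
    note H = Lipschitz_sum_comp[OF lip[OF fg(2)] J(1), of s]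
    have "\<bar>covariance M (\<lambda>\<omega>. ?F (subvector X I \<omega>)) (\<lambda>\<omega>. ?H (subvector X J \<omega>))\<bar>
       \<le> Lipschitz_norm I ?F * Lipschitz_norm J ?H * ?G"
      using dependent I J disj F(1) H(1) unfolding L_weakly_dependent_def by blast
    also have "\<dots> \<le> (\<bar>s\<bar> * \<bar>s\<bar>) * ?G"
      by (intro mult_right_mono mult_mono F H G) auto
    finally show ?thesis by (simp add: subvector_def power2_eq_square)
  qed
  from norm_char_distr_add_diff_le[OF S_measurable[OF I(2)] S_measurable[OF J(2)] this]
  show ?thesis using I J disj by (simp add: sum.union_disjoint)
qed

lemma tail_tendsto_0: "tail \<longlonglongrightarrow> 0"
  unfolding tail_def[abs_def] by (rule suminf_exist_split2[OF summable_\<gamma>])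

lemma sum_\<gamma>_le_tail: "(\<Sum>k<m. \<gamma> (Suc (k + r))) \<le> tail r"
  unfolding tail_def
  by (rule sum_le_suminf[OF summable_ignore_initial_segment[OF summable_\<gamma>]]) (auto intro: \<gamma>_nonneg)

text \<open>Summing over the past of each element of the new block gives one tail per offset. The
  bound is independent of \<open>N\<close>, so every block costs the same.\<close>

lemma sum_\<gamma>_block_le:
  "(\<Sum>i\<in>{1..N}. \<Sum>j\<in>{N + 1..N + l}. \<gamma> (nat \<bar>int j - int i\<bar>)) \<le> (\<Sum>r<l. tail r)"
proof -
  have "(\<Sum>i\<in>{1..N}. \<Sum>j\<in>{N + 1..N + l}. \<gamma> (nat \<bar>int j - int i\<bar>))
      = (\<Sum>j\<in>{N + 1..N + l}. \<Sum>i\<in>{1..N}. \<gamma> (nat \<bar>int j - int i\<bar>))"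
    by (rule sum.swap)
  also have "\<dots> = (\<Sum>r<l. \<Sum>i\<in>{1..N}. \<gamma> (nat \<bar>int (N + 1 + r) - int i\<bar>))"
    by (rule sum.reindex_bij_witness[of _ "\<lambda>r. N + 1 + r" "\<lambda>j. j - (N + 1)"]) auto
  also have "\<dots> = (\<Sum>r<l. \<Sum>k<N. \<gamma> (Suc (k + r)))"
  proof (rule sum.cong[OF refl])
    fix r
    show "(\<Sum>i\<in>{1..N}. \<gamma> (nat \<bar>int (N + 1 + r) - int i\<bar>)) = (\<Sum>k<N. \<gamma> (Suc (k + r)))"
      \<comment> \<open>With \<open>k = N - i\<close> the distance \<open>N + 1 + r - i\<close>
        becomes \<open>Suc (k + r)\<close>.\<close>
      by (rule sum.reindex_bij_witness[of _ "\<lambda>k. N - k" "\<lambda>i. N - i"])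
         (auto intro!: arg_cong[of _ _ \<gamma>])
  qed
  also have "\<dots> \<le> (\<Sum>r<l. tail r)" by (intro sum_mono sum_\<gamma>_le_tail)
  finally show ?thesis .
qed

text \<open>The last block is split off at each step. Errors merely add up, because the factor
  multiplying the earlier error is a characteristic function and has norm at most 1.\<close>

lemma norm_\<phi>_blocks_diff_le:
  "norm (\<phi> {1..m * l} s - \<phi> {1..l} s ^ m) \<le> 4 * (s\<^sup>2 * (real m * (\<Sum>r<l. tail r)))"
proof (induction m)
  case 0
  have "\<phi> {} s = 1" by (subst char_distr) (auto simp: prob_space)
  thus ?case by simp
next
  case (Suc m)
  let ?N = "m * l" and ?T = "\<Sum>r<l. tail r"
  let ?J = "{?N + 1..?N + l}"
  have un: "{1..Suc m * l} = {1..?N} \<union> ?J" by auto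
  have shift: "\<phi> ?J s = \<phi> {1..l} s" by (simp only: distr_S_shift)
  have "norm (\<phi> {1..Suc m * l} s - \<phi> {1..?N} s * \<phi> ?J s)
     \<le> 4 * (s\<^sup>2 * (\<Sum>i\<in>{1..?N}. \<Sum>j\<in>?J. \<gamma> (nat \<bar>int j - int i\<bar>)))"
    unfolding un by (rule norm_\<phi>_union_diff_le) auto
  also have "\<dots> \<le> 4 * (s\<^sup>2 * ?T)"
    by (intro mult_left_mono sum_\<gamma>_block_le) auto
  finally have 1: "norm (\<phi> {1..Suc m * l} s - \<phi> {1..?N} s * \<phi> {1..l} s) \<le> 4 * (s\<^sup>2 * ?T)"
    unfolding shift .
  have "norm ((\<phi> {1..?N} s - \<phi> {1..l} s ^ m) * \<phi> {1..l} s) \<le> norm (\<phi> {1..?N} s - \<phi> {1..l} s ^ m) * 1"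
    unfolding norm_mult by (intro mult_left_mono norm_char_distr_le_1 S_measurable) auto
  hence 2: "norm (\<phi> {1..?N} s * \<phi> {1..l} s - \<phi> {1..l} s ^ Suc m) \<le> 4 * (s\<^sup>2 * (real m * ?T))"
    using Suc.IH by (simp add: algebra_simps)
  show ?case using norm_triangle_mono[OF 1 2] by (simp add: algebra_simps)
qed

section \<open>The remainder and the passage to the limit\<close>

text \<open>A crude first-moment bound is enough: it will be used with \<open>l\<close> fixed and
  \<open>s\<close> tending to 0.\<close>

lemma norm_\<phi>_remainder_le:
  assumes "N \<le> n" "n \<le> N + l"
  shows "norm (\<phi> {1..n} s - \<phi> {1..N} s) \<le> \<bar>s\<bar> * (real l * expectation (\<lambda>\<omega>. \<bar>X 1 \<omega>\<bar>))"
proof -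
  have diff: "S {1..n} \<omega> - S {1..N} \<omega> = S {N<..n} \<omega>" for \<omega>
  proof -
    have "{1..n} = {1..N} \<union> {N<..n}" using assms by auto
    moreover have "S ({1..N} \<union> {N<..n}) \<omega> = S {1..N} \<omega> + S {N<..n} \<omega>"
      by (rule sum.union_disjoint) auto
    ultimately show ?thesis by simp
  qed
  have "norm (\<phi> {1..n} s - \<phi> {1..N} s) \<le> \<bar>s\<bar> * expectation (\<lambda>\<omega>. \<bar>S {1..n} \<omega> - S {1..N} \<omega>\<bar>)"
    by (intro norm_char_distr_diff_le S_measurable Bochner_Integration.integrable_diff integrable_S) auto
  also have "expectation (\<lambda>\<omega>. \<bar>S {1..n} \<omega> - S {1..N} \<omega>\<bar>) \<le> expectation (\<lambda>\<omega>. \<Sum>i\<in>{N<..n}. \<bar>X i \<omega>\<bar>)"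
    unfolding diff
    by (intro integral_mono Bochner_Integration.integrable_sum integrable_abs integrable_S integrable_X)
       (auto intro: sum_abs)
  also have "\<dots> = (\<Sum>i\<in>{N<..n}. expectation (\<lambda>\<omega>. \<bar>X i \<omega>\<bar>))"
    by (intro Bochner_Integration.integral_sum integrable_abs integrable_X) auto
  also have "\<dots> = (\<Sum>i\<in>{N<..n}. expectation (\<lambda>\<omega>. \<bar>X 1 \<omega>\<bar>))"
    by (intro sum.cong refl expectation_abs_X) auto
  also have "\<dots> = real (n - N) * expectation (\<lambda>\<omega>. \<bar>X 1 \<omega>\<bar>)"
    by simp
  also have "\<dots> \<le> real l * expectation (\<lambda>\<omega>. \<bar>X 1 \<omega>\<bar>)"
    using assms by (intro mult_right_mono) auto
  finally show ?thesis by (simp add: mult_left_mono)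
qed

lemma \<phi>_tendsto:
  assumes var: "(\<lambda>n. expectation (\<lambda>\<omega>. (S {1..n} \<omega>)\<^sup>2) / real n) \<longlonglongrightarrow> \<sigma>\<^sup>2"
  shows "(\<lambda>n. \<phi> {1..n} (t / sqrt (real n))) \<longlonglongrightarrow> complex_of_real (exp (- (\<sigma> * t)\<^sup>2 / 2))"
proof (rule LIMSEQ_I)
  fix e :: real assume e: "0 < e"
  \<comment> \<open>\<open>A l\<close> is the limit from \<open>char_power_tendsto\<close> with
    \<open>c = 1 / real l\<close>. \<open>D l\<close> bounds the cost of decoupling uniformly in
    \<open>n > 0\<close>, as \<open>s\<^sup>2 = t\<^sup>2 / n\<close> and
    \<open>n div l \<le> n / l\<close>.\<close>
  define A where "A l = exp (- (1 / real l * expectation (\<lambda>\<omega>. (S {1..l} \<omega>)\<^sup>2) * t\<^sup>2 / 2))" for l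
  define D where "D l = 4 * (t\<^sup>2 * ((\<Sum>r<l. tail r) / real l))" for l
  define L where "L = exp (- (\<sigma> * t)\<^sup>2 / 2)"
  have "(\<lambda>l. exp (- (expectation (\<lambda>\<omega>. (S {1..l} \<omega>)\<^sup>2) / real l * t\<^sup>2 / 2))) \<longlonglongrightarrow> exp (- (\<sigma>\<^sup>2 * t\<^sup>2 / 2))"
    by (intro tendsto_exp tendsto_minus tendsto_divide tendsto_mult tendsto_const var) simp
  hence "A \<longlonglongrightarrow> exp (- (\<sigma>\<^sup>2 * t\<^sup>2 / 2))" unfolding A_def by simp
  hence A: "A \<longlonglongrightarrow> L" by (simp add: L_def power_mult_distrib)
  have "D \<longlonglongrightarrow> 4 * (t\<^sup>2 * 0)"
    unfolding D_def by (intro tendsto_intros cesaro_mean_tendsto_0 tail_tendsto_0)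
  hence D: "D \<longlonglongrightarrow> 0" by simp
  have "\<forall>\<^sub>F l in sequentially. \<bar>A l - L\<bar> < e / 4 \<and> D l < e / 4 \<and> l > 0"
    using tendstoD[OF A, of "e / 4"] order_tendstoD(2)[OF D, of "e / 4"] eventually_gt_at_top[of 0] e
    by (simp add: dist_real_def eventually_conj_iff)
  \<comment> \<open>The block length is fixed before \<open>n\<close> grows. Each of the four errors
    (remainder, decoupling, i.i.d. limit, \<open>A l\<close> against \<open>L\<close>) gets
    \<open>e / 4\<close>.\<close>
  then obtain l where l: "\<bar>A l - L\<bar> < e / 4" "D l < e / 4" "l > 0"
    by (auto simp: eventually_sequentially)
  define E where "E = real l * expectation (\<lambda>\<omega>. \<bar>X 1 \<omega>\<bar>)"
  have T0: "0 \<le> (\<Sum>r<l. tail r)"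
    \<comment> \<open>The empty partial sum, \<open>m = 0\<close>, shows that every tail is
      nonnegative.\<close>
    using sum_\<gamma>_le_tail[where m = 0] by (intro sum_nonneg) simp
  have "(\<lambda>n. real (n div l) / real n) \<longlonglongrightarrow> 1 / real l"
  proof (rule tendsto_sandwich)
    have "real (n div l) * real l + real (n mod l) = real n" for n
      by (metis div_mult_mod_eq of_nat_add of_nat_mult)
    moreover have "real (n mod l) \<le> real l" for n using l(3) by (simp add: less_imp_le)
    ultimately have *: "real (n div l) * real l \<le> real n" "real n \<le> real (n div l) * real l + real l" for n
      by (metis le_add_same_cancel1 of_nat_0_le_iff, metis add_left_mono)
    have "1 / real l - 1 / real n \<le> real (n div l) / real n" if "n > 0" for n
    proof -
      have "real n / real l - 1 \<le> real (n div l)" using *(2)[of n] l(3) by (simp add: field_simps)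
      hence "(real n / real l - 1) / real n \<le> real (n div l) / real n" by (rule divide_right_mono) simp
      thus ?thesis using that by (simp add: diff_divide_distrib)
    qed
    thus "\<forall>\<^sub>F n in sequentially. 1 / real l - 1 / real n \<le> real (n div l) / real n"
      by (auto intro: eventually_mono[OF eventually_gt_at_top[of 0]])
    show "\<forall>\<^sub>F n in sequentially. real (n div l) / real n \<le> 1 / real l"
      using eventually_gt_at_top[of 0] by eventually_elim (use * l(3) in \<open>simp add: field_simps\<close>)
    show "(\<lambda>n. 1 / real l - 1 / real n) \<longlonglongrightarrow> 1 / real l"
      using tendsto_diff[OF tendsto_const[of "1 / real l"] lim_1_over_n] by simp
  qed simp
  hence "(\<lambda>n. \<phi> {1..l} (t / sqrt (real n)) ^ (n div l)) \<longlonglongrightarrow> complex_of_real (A l)"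
    unfolding A_def
    by (intro char_power_tendsto S_measurable integrable_S integrable_S_square expectation_S) auto
  hence ev1: "\<forall>\<^sub>F n in sequentially. norm (\<phi> {1..l} (t / sqrt (real n)) ^ (n div l) - complex_of_real (A l)) < e / 4"
    using e by (auto dest: tendstoD[of _ _ _ "e / 4"] simp: dist_norm)
  have "(\<lambda>n. \<bar>t / sqrt (real n)\<bar> * E) \<longlonglongrightarrow> \<bar>0\<bar> * E"
    by (intro tendsto_intros tendsto_divide_sqrt_0)
  hence ev2: "\<forall>\<^sub>F n in sequentially. \<bar>t / sqrt (real n)\<bar> * E < e / 4"
    using e by (auto dest: order_tendstoD(2)[of _ _ _ "e / 4"])
  have "\<forall>\<^sub>F n in sequentially. norm (\<phi> {1..n} (t / sqrt (real n)) - complex_of_real L) < e"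
    using ev1 ev2 eventually_gt_at_top[of 0]
  proof eventually_elim
    case (elim n)
    let ?s = "t / sqrt (real n)" and ?m = "n div l"
    have "n = ?m * l + n mod l" by simp
    moreover have "n mod l < l" using l by simp
    ultimately have "?m * l \<le> n" "n \<le> ?m * l + l" by linarith+
    from norm_\<phi>_remainder_le[OF this, of ?s]
    have 1: "norm (\<phi> {1..n} ?s - \<phi> {1..?m * l} ?s) < e / 4" using elim(2) unfolding E_def by linarith
    have "real ?m / real n \<le> 1 / real l"
    proof -
      have "real (?m * l) \<le> real n" using \<open>?m * l \<le> n\<close> of_nat_le_iff by blast
      thus ?thesis using elim(3) l by (simp add: field_simps)
    qed
    hence "4 * t\<^sup>2 * (\<Sum>r<l. tail r) * (real ?m / real n) \<le> 4 * t\<^sup>2 * (\<Sum>r<l. tail r) * (1 / real l)"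
      by (rule mult_left_mono) (simp add: T0)
    moreover have "4 * (?s\<^sup>2 * (real ?m * (\<Sum>r<l. tail r))) = 4 * t\<^sup>2 * (\<Sum>r<l. tail r) * (real ?m / real n)"
      by (simp add: power_divide)
    moreover have "D l = 4 * t\<^sup>2 * (\<Sum>r<l. tail r) * (1 / real l)"
      by (simp add: D_def)
    ultimately have "4 * (?s\<^sup>2 * (real ?m * (\<Sum>r<l. tail r))) \<le> D l"
      by linarith
    with norm_\<phi>_blocks_diff_le[of ?m l ?s] l
    have 2: "norm (\<phi> {1..?m * l} ?s - \<phi> {1..l} ?s ^ ?m) < e / 4" by linarith
    have "norm (complex_of_real (A l) - complex_of_real L) = \<bar>A l - L\<bar>"
      by (metis norm_of_real of_real_diff real_norm_def)
    hence 3: "norm (complex_of_real (A l) - complex_of_real L) < e / 4" using l by simp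
    show ?case
      \<comment> \<open>The chain runs from the full sum to the full blocks, to the power for
        independent blocks, to \<open>A l\<close>, and to \<open>L\<close>.\<close>
      using norm_diff_triangle_less[OF norm_diff_triangle_less[OF 1 2]
              norm_diff_triangle_less[OF elim(1) 3]] by simp
  qed
  thus "\<exists>no. \<forall>n\<ge>no. norm (\<phi> {1..n} (t / sqrt (real n)) - complex_of_real (exp (- (\<sigma> * t)\<^sup>2 / 2))) < e"
    by (simp add: eventually_sequentially L_def)
qed

end

section \<open>Convergence in distribution by the Levy continuity theorem\<close>

theorem theorem15:
  fixes M :: "'a measure"
    and X :: "nat \<Rightarrow> 'a \<Rightarrow> real"
    and \<gamma> :: "nat \<Rightarrow> real"
    and \<sigma> :: real
  assumes "prob_space M"
    and "\<And>n. n \<ge> 1 \<Longrightarrow> X n \<in> borel_measurable M"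
    and "\<And>n. n \<ge> 1 \<Longrightarrow> integrable M (\<lambda>\<omega>. (X n \<omega>)\<^sup>2)"
    and "\<And>n. n \<ge> 1 \<Longrightarrow> (\<integral>\<omega>. X n \<omega> \<partial>M) = 0"
    and "L_weakly_dependent M X \<gamma>"
    and "strictly_stationary M X"
    and "\<sigma> > 0"
    and "(\<lambda>n. (\<integral>\<omega>. (\<Sum>i=1..n. X i \<omega>)\<^sup>2 \<partial>M) / real n) \<longlonglongrightarrow> \<sigma>\<^sup>2"
  shows "weak_conv_m (\<lambda>n. distr M borel (\<lambda>\<omega>. (\<Sum>i=1..n. X i \<omega>) / sqrt (real n)))
           (density lborel (normal_density 0 \<sigma>))"
proof -
  interpret L_weak_stationary_sequence M X \<gamma>
    using assms by (intro L_weak_stationary_sequence.intro L_weak_stationary_sequence_axioms.intro) auto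
  have m: "S {1..n} \<in> borel_measurable M" for n by (rule S_measurable) auto
  show ?thesis
  proof (rule levy_continuity)
    show "real_distribution (distr M borel (\<lambda>\<omega>. S {1..n} \<omega> / sqrt (real n)))" for n
      using m by (intro real_distribution_distr) simp
    show "real_distribution (density lborel (normal_density 0 \<sigma>))"
      using prob_space_normal_density[OF \<open>\<sigma> > 0\<close>]
      by (auto simp: real_distribution_def real_distribution_axioms_def)
    fix t
    \<comment> \<open>Scaling the sum moves into the argument; for \<open>n = 0\<close> both
      quotients by \<open>sqrt (real n)\<close> are 0 by convention.\<close>
    have "char (distr M borel (\<lambda>\<omega>. S {1..n} \<omega> / sqrt (real n))) t = \<phi> {1..n} (t / sqrt (real n))" for n
      using m by (simp add: char_distr)
    thus "(\<lambda>n. char (distr M borel (\<lambda>\<omega>. S {1..n} \<omega> / sqrt (real n))) t)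
        \<longlonglongrightarrow> char (density lborel (normal_density 0 \<sigma>)) t"
      using \<phi>_tendsto[OF assms(8)] by (simp add: char_normal_density[OF \<open>\<sigma> > 0\<close>])
  qed
qed

end
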